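(* For every integer $n\ge0$, \[ T_{n+1}=\sum_{j+r+s=n}\binom{j}{r}\binom{r}{s}. \]
   Context: $T_n$ denotes the tribonacci number defined by $T_i=0$ for $i<1$, $T_1=T_2=1$, and $T_n=T_{n-1}+T_{n-2}+T_{n-3}$ for $n\ge3$. The sum is over nonnegative integers $j,r,s$ with $j+r+s=n$, and $\binom{a}{b}=0$ when $0\le a<b$. *)

theory Defs
  imports Main
begin

function trib :: "int \<Rightarrow> nat" where
  "trib i = (if i < 1 then 0
             else if i = 1 \<or> i = 2 then 1
             else trib (i - 1) + trib (i - 2) + trib (i - 3))"
  by auto
termination by (relation "measure nat") auto

(* As a rewrite rule the equation loops. *)
declare trib.simps [simp del]

end

theory Submission
  imports Defs
begin

text \<open>
  The identity compares coefficients in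
  \[ \frac{1}{1-x-x^2-x^3} = \sum_{j\ge 0} x^j (1+x+x^2)^j, \]
  whose left side generates $T_{n+1}$. Expanding $(1+x(1+x))^j$ by the binomial theorem twice
  shows that the coefficient of $x^m$ in $(1+x+x^2)^j$ is
  $\sum_{r+s=m}\binom{j}{r}\binom{r}{s}$; so the triple sum is the coefficient of $x^n$ on the right.

  The proof stays with these trinomial coefficients. Multiplying by one more factor $1+x+x^2$
  gives the three-term rule \<open>trinom_Suc\<close>, which is Pascal's rule applied to both binomials.
  Summed along the lines $j+m=n$, it becomes the tribonacci recurrence \<open>diag_rec\<close>.
\<close>

definition trinom :: "nat \<Rightarrow> nat \<Rightarrow> nat" where
  "trinom j m = (\<Sum>r\<le>m. (j choose r) * (r choose (m - r)))"

lemma trinom_0_right [simp]: "trinom j 0 = 1"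
  by (simp add: trinom_def)

lemma trinom_0_left: "m > 0 \<Longrightarrow> trinom 0 m = 0"
  unfolding trinom_def by (intro sum.neutral) (auto simp: binomial_eq_0_iff)

text \<open>Pascal's rule on the upper binomial, which in terms of polynomials splits off
  $x(1+x)\cdot(1+x+x^2)^j$ from the product $(1+x(1+x))\cdot(1+x+x^2)^j$.\<close>

lemma trinom_Suc_Suc:
  "trinom (Suc j) (Suc m) =
    trinom j (Suc m) + (\<Sum>r\<le>m. (j choose r) * (Suc r choose (m - r)))"
proof -
  have "trinom (Suc j) (Suc m) =
      (\<Sum>r\<le>m. (Suc j choose Suc r) * (Suc r choose (m - r)))"
    unfolding trinom_def by (subst sum.atMost_Suc_shift) simp
  moreover have "trinom j (Suc m) =
      (\<Sum>r\<le>m. (j choose Suc r) * (Suc r choose (m - r)))"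
    unfolding trinom_def by (subst sum.atMost_Suc_shift) simp
  ultimately show ?thesis
    by (simp add: sum.distrib algebra_simps del: binomial_Suc_Suc add: binomial_Suc_Suc[of j])
qed

lemma trinom_Suc_1: "trinom (Suc j) (Suc 0) = trinom j (Suc 0) + trinom j 0"
  by (simp add: trinom_Suc_Suc)

text \<open>Pascal's rule on the lower binomial splits the factor $1+x$ in the same way.\<close>

lemma trinom_Suc:
  "trinom (Suc j) (Suc (Suc m)) = trinom j (Suc (Suc m)) + trinom j (Suc m) + trinom j m"
proof -
  have "(\<Sum>r\<le>m. (j choose r) * (Suc r choose (Suc m - r))) =
      (\<Sum>r\<le>m. (j choose r) * (r choose (Suc m - r)) + (j choose r) * (r choose (m - r)))"
    by (intro sum.cong) (auto simp: Suc_diff_le algebra_simps)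
  hence "(\<Sum>r\<le>Suc m. (j choose r) * (Suc r choose (Suc m - r))) =
      trinom j (Suc m) + trinom j m"
    by (simp add: trinom_def sum.distrib)
  thus ?thesis
    by (simp only: trinom_Suc_Suc add.assoc)
qed

definition diag :: "nat \<Rightarrow> nat" where
  "diag n = (\<Sum>j\<le>n. trinom j (n - j))"

lemma diag_rec:
  "diag (Suc (Suc (Suc n))) = diag (Suc (Suc n)) + diag (Suc n) + diag n"
proof -
  have "diag (Suc (Suc (Suc n))) = (\<Sum>j\<le>Suc (Suc n). trinom (Suc j) (Suc (Suc n) - j))"
    unfolding diag_def by (subst sum.atMost_Suc_shift) (simp add: trinom_0_left)
  also have "\<dots> = (\<Sum>j\<le>n. trinom (Suc j) (Suc (Suc (n - j))))
      + trinom (Suc (Suc n)) (Suc 0) + trinom (Suc (Suc (Suc n))) 0"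
    by (simp add: Suc_diff_le)
  also have "\<dots> = (\<Sum>j\<le>n. trinom j (Suc (Suc (n - j)))) + (\<Sum>j\<le>n. trinom j (Suc (n - j)))
      + (\<Sum>j\<le>n. trinom j (n - j)) + trinom (Suc n) (Suc 0) + 1 + 1"
    by (simp add: trinom_Suc trinom_Suc_1 sum.distrib)
  also have "\<dots> = diag (Suc (Suc n)) + diag (Suc n) + diag n"
    by (simp add: diag_def Suc_diff_le)
  finally show ?thesis .
qed

lemma trib_eq_diag: "trib (int n + 1) = diag n"
proof (induction n rule: less_induct)
  case (less n)
  consider "n = 0" | "n = 1" | "n = 2" | k where "n = Suc (Suc (Suc k))"
    by (metis One_nat_def Suc_1 not0_implies_Suc)
  then show ?case
  proof cases
    case 1
    then show ?thesis by (simp add: trib.simps[of 1] diag_def)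
  next
    case 2
    then show ?thesis by (simp add: trib.simps[of 2] diag_def trinom_0_left)
  next
    case 3
    have "trib 3 = 2"
      by (simp add: trib.simps[of 3] trib.simps[of 2] trib.simps[of 1] trib.simps[of 0])
    moreover have "diag 2 = 2"
      by (simp add: diag_def numeral_2_eq_2 trinom_0_left trinom_Suc_1)
    ultimately show ?thesis using 3 by simp
  next
    case 4
    have "trib (int n + 1) =
        trib (int (Suc (Suc k)) + 1) + trib (int (Suc k) + 1) + trib (int k + 1)"
      using 4 by (subst trib.simps) (simp add: algebra_simps)
    then show ?thesis
      using 4 less.IH by (simp only: diag_rec)
  qed
qed

lemma diag_eq_triple_sum:
  "diag n = (\<Sum>(j, r, s) \<in> {(j, r, s). j + r + s = n}. (j choose r) * (r choose s))"
proof -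
  have "diag n = (\<Sum>(j, r)\<in>(SIGMA j:{..n}. {..n - j}). (j choose r) * (r choose (n - j - r)))"
    unfolding diag_def trinom_def by (subst sum.Sigma) auto
  also have "\<dots> = (\<Sum>(j, r, s) \<in> {(j, r, s). j + r + s = n}. (j choose r) * (r choose s))"
    by (rule sum.reindex_bij_witness[of _ "\<lambda>(j, r, s). (j, r)" "\<lambda>(j, r). (j, r, n - j - r)"]) auto
  finally show ?thesis .
qed

theorem mainTheorem11:
  fixes n :: nat
  shows "trib (int n + 1) =
    (\<Sum>(j, r, s) \<in> {(j :: nat, r :: nat, s :: nat). j + r + s = n}. (j choose r) * (r choose s))"
  by (simp only: trib_eq_diag diag_eq_triple_sum)

end
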